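(* Every graph with no $K_4$ minor admits an odd $5$-coloring.
   Context: All graphs are simple, finite, and undirected. $K_4$ denotes the complete graph on $4$ vertices. A proper coloring of a graph $G$ is odd if every non-isolated vertex of $G$ has some color that appears an odd number of times on its neighborhood. An odd $k$-coloring is an odd (proper) coloring using colors from $\{1,\dots,k\}$ (not all colors need be used). *)

theory Defs
  imports "Graph_Theory.Graph_Theory"
begin

text \<open>
  Finite simple undirected graphs are those satisfying the locale predicate
  \<^locale>\<open>graph\<close>: every undirected edge is represented by a pair of opposite arcs.
\<close>

definition neighborhood :: "('a, 'b) pre_digraph \<Rightarrow> 'a \<Rightarrow> 'a set" where
  "neighborhood G v = {u. v \<rightarrow>\<^bsub>G\<^esub> u}"

definition isolated :: "('a, 'b) pre_digraph \<Rightarrow> 'a \<Rightarrow> bool" where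
  "isolated G v \<longleftrightarrow> neighborhood G v = {}"

definition proper_coloring :: "('a, 'b) pre_digraph \<Rightarrow> ('a \<Rightarrow> 'c) \<Rightarrow> bool" where
  "proper_coloring G c \<longleftrightarrow> (\<forall>u v. u \<rightarrow>\<^bsub>G\<^esub> v \<longrightarrow> c u \<noteq> c v)"

definition odd_coloring :: "('a, 'b) pre_digraph \<Rightarrow> ('a \<Rightarrow> 'c) \<Rightarrow> bool" where
  "odd_coloring G c \<longleftrightarrow> proper_coloring G c \<and>
     (\<forall>v\<in>verts G. \<not> isolated G v \<longrightarrow> (\<exists>i. odd (card {u \<in> neighborhood G v. c u = i})))"

definition odd_k_coloring :: "nat \<Rightarrow> ('a, 'b) pre_digraph \<Rightarrow> ('a \<Rightarrow> nat) \<Rightarrow> bool" where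
  "odd_k_coloring k G c \<longleftrightarrow> odd_coloring G c \<and> c ` verts G \<subseteq> {1..k}"

text \<open>
  A graph is a minor of another one if it can be obtained by contracting disjoint connected
  vertex sets (the branch sets \<open>B x\<close>) and deleting vertices and edges. Branch sets are
  nonempty because \<^const>\<open>Digraph_Component.connected\<close> fails for the graph without vertices.
\<close>

definition minor_model ::
  "('c, 'd) pre_digraph \<Rightarrow> ('a, 'b) pre_digraph \<Rightarrow> ('c \<Rightarrow> 'a set) \<Rightarrow> bool" where
  "minor_model H G B \<longleftrightarrow>
     (\<forall>x\<in>verts H. B x \<subseteq> verts G \<and> Digraph_Component.connected (G \<restriction> B x)) \<and>
     (\<forall>x\<in>verts H. \<forall>y\<in>verts H. x \<noteq> y \<longrightarrow> B x \<inter> B y = {}) \<and>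
     (\<forall>x y. x \<rightarrow>\<^bsub>H\<^esub> y \<longrightarrow> (\<exists>u\<in>B x. \<exists>v\<in>B y. u \<rightarrow>\<^bsub>G\<^esub> v))"

definition is_minor :: "('c, 'd) pre_digraph \<Rightarrow> ('a, 'b) pre_digraph \<Rightarrow> bool" where
  "is_minor H G \<longleftrightarrow> (\<exists>B. minor_model H G B)"

text \<open>
  \<^const>\<open>complete_digraph\<close> is a predicate on graphs; the type \<^typ>\<open>nat\<close> provides
  enough vertices for a complete graph of every finite order.
\<close>

definition has_complete_minor :: "nat \<Rightarrow> ('a, 'b) pre_digraph \<Rightarrow> bool" where
  "has_complete_minor n G \<longleftrightarrow>
     (\<exists>H :: nat pair_pre_digraph. K\<^bsub>n\<^esub> (with_proj H) \<and> is_minor (with_proj H) G)"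

end

theory Submission
  imports Defs
begin

text \<open>
  A nonempty graph without a \<open>K\<^sub>4\<close> minor has a vertex \<open>v\<close> of degree at most 2. Delete \<open>v\<close>
  and join its two neighbours; this is a minor, so it has an odd 5-coloring by induction. In that
  coloring the neighbours of \<open>v\<close> have different colours, which makes \<open>v\<close> odd, and each
  neighbour excludes at most two colours for \<open>v\<close>: its own colour, and the colour that would
  spoil its own oddness.
\<close>

section \<open>Graphs as relations, connectivity by cuts, models of complete graphs\<close>

text \<open>Vertex sets and symmetric relations replace arcs, since the inductions delete vertices,
  contract edges and add edges.\<close>

definition simple_rel :: "'a set \<Rightarrow> ('a \<Rightarrow> 'a \<Rightarrow> bool) \<Rightarrow> bool" where
  "simple_rel V E \<longleftrightarrow> finite V \<and> (\<forall>u v. E u v \<longrightarrow> u \<in> V \<and> v \<in> V \<and> u \<noteq> v \<and> E v u)"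

text \<open>Connectivity phrased without paths: its negation directly supplies a set that no edge
  leaves, which is how separations enter the argument.\<close>

definition cut_connected :: "('a \<Rightarrow> 'a \<Rightarrow> bool) \<Rightarrow> 'a set \<Rightarrow> bool" where
  "cut_connected E S \<longleftrightarrow>
     S \<noteq> {} \<and> (\<forall>A. A \<subseteq> S \<and> A \<noteq> {} \<and> A \<noteq> S \<longrightarrow> (\<exists>a\<in>A. \<exists>b\<in>S - A. E a b))"

definition complete_model :: "nat \<Rightarrow> 'a set \<Rightarrow> ('a \<Rightarrow> 'a \<Rightarrow> bool) \<Rightarrow> (nat \<Rightarrow> 'a set) \<Rightarrow> bool" where
  "complete_model n V E B \<longleftrightarrow>
     (\<forall>i<n. B i \<subseteq> V \<and> cut_connected E (B i)) \<and>
     (\<forall>i<n. \<forall>j<n. i \<noteq> j \<longrightarrow> B i \<inter> B j = {} \<and> (\<exists>u\<in>B i. \<exists>v\<in>B j. E u v))"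

text \<open>The edge \<open>x z\<close> is contracted into \<open>x\<close>, so the new graph lives
  on a subset of the old vertices. Requiring \<open>a \<noteq> b\<close> removes the loop that the
  edge itself would leave.\<close>

definition contract :: "('a \<Rightarrow> 'a \<Rightarrow> bool) \<Rightarrow> 'a \<Rightarrow> 'a \<Rightarrow> 'a \<Rightarrow> 'a \<Rightarrow> bool" where
  "contract E x z a b \<longleftrightarrow>
     a \<noteq> b \<and> a \<noteq> z \<and> b \<noteq> z \<and> (E a b \<or> a = x \<and> E z b \<or> b = x \<and> E a z)"

lemma simple_relD:
  assumes "simple_rel V E"
  shows "finite V" "E u v \<Longrightarrow> u \<in> V" "E u v \<Longrightarrow> v \<in> V" "\<not> E u u" "E u v \<Longrightarrow> E v u"
  using assms unfolding simple_rel_def by blast+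

lemma simple_rel_contract:
  assumes "simple_rel V E" "x \<in> V"
  shows "simple_rel (V - {z}) (contract E x z)"
  using assms unfolding simple_rel_def contract_def by auto

lemma simple_rel_induced:
  assumes "simple_rel V E"
  shows "simple_rel (V \<inter> W) (\<lambda>a b. E a b \<and> a \<in> W \<and> b \<in> W)"
  using assms unfolding simple_rel_def by auto

lemma finite_nbrs: "simple_rel V E \<Longrightarrow> finite {w. E v w}"
  by (rule finite_subset[of _ V]) (auto dest: simple_relD)

lemma cut_connectedD:
  assumes "cut_connected E S" "A \<subseteq> S" "A \<noteq> {}" "A \<noteq> S"
  obtains a b where "a \<in> A" "b \<in> S - A" "E a b"
  using assms unfolding cut_connected_def by blast

lemma cut_connected_mono:
  assumes "cut_connected E S" "\<And>a b. a \<in> S \<Longrightarrow> b \<in> S \<Longrightarrow> E a b \<Longrightarrow> F a b"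
  shows "cut_connected F S"
  unfolding cut_connected_def
proof (intro conjI allI impI)
  show "S \<noteq> {}" using assms(1) by (simp add: cut_connected_def)
  fix A assume "A \<subseteq> S \<and> A \<noteq> {} \<and> A \<noteq> S"
  then have A: "A \<subseteq> S" "A \<noteq> {}" "A \<noteq> S" by auto
  then obtain a b where "a \<in> A" "b \<in> S - A" "E a b"
    using cut_connectedD[OF assms(1)] by metis
  with A(1) assms(2) show "\<exists>a\<in>A. \<exists>b\<in>S - A. F a b" by blast
qed

lemma cut_connected_singleton: "cut_connected E {x}"
  unfolding cut_connected_def by auto

lemma complete_model_mono:
  assumes "complete_model n V E B" "V \<subseteq> W" "\<And>a b. E a b \<Longrightarrow> F a b"
  shows "complete_model n W F B"
proof -
  have "cut_connected F (B i)" if "i < n" for i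
    using assms(1,3) that cut_connected_mono[of E "B i" F] unfolding complete_model_def by blast
  then show ?thesis
    using assms unfolding complete_model_def by (meson subset_trans)
qed

section \<open>Lifting models through a contraction\<close>

text \<open>A cut separating \<open>x\<close> from \<open>z\<close> is crossed by the edge between
  them. Any other cut restricts to a cut of \<open>S\<close>, and the contracted edge crossing it
  comes from an edge of \<open>E\<close>, possibly with \<open>z\<close> in place of
  \<open>x\<close> on the same side.\<close>

lemma cut_connected_uncontract:
  assumes "cut_connected (contract E x z) S" "x \<in> S" "E x z" "E z x" "z \<notin> S"
  shows "cut_connected E (insert z S)"
  unfolding cut_connected_def
proof (intro conjI allI impI)
  fix A assume A: "A \<subseteq> insert z S \<and> A \<noteq> {} \<and> A \<noteq> insert z S"
  show "\<exists>a\<in>A. \<exists>b\<in>insert z S - A. E a b"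
  proof (rule ccontr)
    assume no: "\<not> ?thesis"
    then have xz: "x \<in> A \<longleftrightarrow> z \<in> A" using assms A by blast
    have 1: "A - {z} \<subseteq> S" using A by blast
    have 2: "A - {z} \<noteq> {}" using A xz assms by blast
    have 3: "A - {z} \<noteq> S" using A xz assms by blast
    obtain a b where "a \<in> A - {z}" "b \<in> S - (A - {z})" "contract E x z a b"
      using cut_connectedD[OF assms(1) 1 2 3] .
    then show False using no xz A assms unfolding contract_def by blast
  qed
qed auto

text \<open>The branch set containing \<open>x\<close>, if there is one, also receives
  \<open>z\<close>; it then has all edges that the contraction attributed to
  \<open>x\<close>.\<close>

lemma complete_model_uncontract:
  assumes "simple_rel V E" "E x z" "complete_model n (V - {z}) (contract E x z) B"
  shows "\<exists>B. complete_model n V E B"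
proof -
  define B' where "B' i = (if x \<in> B i then insert z (B i) else B i)" for i
  have E: "E x z" "E z x" "x \<in> V" "z \<in> V" using assms simple_relD[OF assms(1)] by blast+
  have B: "B i \<subseteq> V - {z}" "cut_connected (contract E x z) (B i)" if "i < n" for i
    using assms(3) that unfolding complete_model_def by blast+
  have BB: "B i \<inter> B j = {}" "\<exists>u\<in>B i. \<exists>v\<in>B j. contract E x z u v" if "i < n" "j < n" "i \<noteq> j" for i j
    using assms(3) that unfolding complete_model_def by blast+
  have "complete_model n V E B'"
    unfolding complete_model_def
  proof (intro conjI allI impI)
    fix i assume i: "i < n"
    show "B' i \<subseteq> V" using B[OF i] E by (auto simp: B'_def)
    show "cut_connected E (B' i)"
    proof (cases "x \<in> B i")
      case True
      then show ?thesis
        using cut_connected_uncontract[OF B(2)[OF i] True] E B[OF i] by (auto simp: B'_def)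
    next
      case False
      then show ?thesis
        using cut_connected_mono[OF B(2)[OF i], of E] by (auto simp: B'_def contract_def)
    qed
    fix j assume j: "j < n" "i \<noteq> j"
    have "z \<notin> B i" "z \<notin> B j" using B i j by blast+
    then show "B' i \<inter> B' j = {}" using BB(1)[OF i j] by (auto simp: B'_def)
    obtain u v where uv: "u \<in> B i" "v \<in> B j" "contract E x z u v" using BB(2)[OF i j] by blast
    have "B i \<subseteq> B' i" "B j \<subseteq> B' j" "x \<in> B i \<Longrightarrow> z \<in> B' i" "x \<in> B j \<Longrightarrow> z \<in> B' j"
      by (auto simp: B'_def)
    then show "\<exists>u\<in>B' i. \<exists>v\<in>B' j. E u v" using uv unfolding contract_def by blast
  qed
  then show ?thesis by blast
qed

section \<open>Existence of a vertex of degree at most 2\<close>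

text \<open>Given a cut of the smaller set, \<open>w\<close> is put on the side of its only possible
  neighbour \<open>t\<close>. The edge crossing the enlarged cut then cannot be incident to
  \<open>w\<close>.\<close>

lemma cut_connected_remove_leaf:
  assumes "cut_connected E S" "S \<noteq> {w}"
    and leaf: "\<And>a. a \<in> S \<Longrightarrow> E a w \<Longrightarrow> a = t" "\<And>a. a \<in> S \<Longrightarrow> E w a \<Longrightarrow> a = t"
  shows "cut_connected E (S - {w})"
  unfolding cut_connected_def
proof (intro conjI allI impI)
  show "S - {w} \<noteq> {}" using assms unfolding cut_connected_def by blast
  fix A assume A: "A \<subseteq> S - {w} \<and> A \<noteq> {} \<and> A \<noteq> S - {w}"
  show "\<exists>a\<in>A. \<exists>b\<in>S - {w} - A. E a b"
  proof (cases "t \<in> A")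
    case True
    let ?A = "A \<union> ({w} \<inter> S)"
    have "?A \<subseteq> S" "?A \<noteq> {}" "?A \<noteq> S" using A by blast+
    then obtain a b where "a \<in> ?A" "b \<in> S - ?A" "E a b"
      using cut_connectedD[OF assms(1)] by metis
    then show ?thesis using leaf True by blast
  next
    case False
    have "A \<subseteq> S" "A \<noteq> {}" "A \<noteq> S" using A by blast+
    then obtain a b where "a \<in> A" "b \<in> S - A" "E a b"
      using cut_connectedD[OF assms(1)] by metis
    then show ?thesis using leaf False A by blast
  qed
qed

lemma card_ge_3_other:
  assumes "card N \<ge> 3"
  obtains t where "t \<in> N" "t \<noteq> x" "t \<noteq> y"
proof -
  have "\<not> N \<subseteq> {x, y}"
  proof
    assume "N \<subseteq> {x, y}"
    then have "card N \<le> card {x, y}" by (rule card_mono[rotated]) auto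
    also have "\<dots> \<le> 2" by (simp add: card_insert_if)
    finally show False using assms by simp
  qed
  then show ?thesis using that by blast
qed

text \<open>A triangle of singletons together with one connected set \<open>S\<close> that is
  adjacent to all three corners forms the four branch sets.\<close>

lemma k4_model_from_parts:
  assumes E: "simple_rel V E" and xzw: "E x z" "E x w" "E z w"
    and S: "cut_connected E S" "S \<subseteq> V - {x, z, w}"
    and adj: "p \<in> S" "E x p" "q \<in> S" "E z q" "r \<in> S" "E w r"
  shows "\<exists>B. complete_model 4 V E B"
proof -
  define B where "B i = (if i = 0 then {x} else if i = 1 then {z} else if i = 2 then {w} else S)"
    for i :: nat
  have V: "x \<in> V" "z \<in> V" "w \<in> V" using xzw simple_relD[OF E] by blast+
  have ne: "x \<noteq> z" "x \<noteq> w" "z \<noteq> w" using xzw simple_relD[OF E] by blast+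
  have sym: "E a b" if "E b a" for a b using that simple_relD[OF E] by blast
  have four: "i = 0 \<or> i = 1 \<or> i = 2 \<or> i = 3" if "i < 4" for i :: nat using that by auto
  have disj: "B i \<inter> B j = {}" if "i < 4" "j < 4" "i \<noteq> j" for i j
    using four[OF that(1)] four[OF that(2)] that(3) ne S(2) by (auto simp: B_def)
  have con: "B i \<subseteq> V \<and> cut_connected E (B i)" if "i < 4" for i
    using four[OF that] S V by (auto simp: B_def cut_connected_singleton)
  have edg: "\<exists>u\<in>B i. \<exists>v\<in>B j. E u v" if "i < 4" "j < 4" "i \<noteq> j" for i j
    using four[OF that(1)] four[OF that(2)] that(3) xzw adj sym
    by (elim disjE) (simp_all add: B_def, blast+)
  show ?thesis
    unfolding complete_model_def using con disj edg by (intro exI[of _ B]) simp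
qed

text \<open>
  Allowing two adjacent vertices of small degree makes the induction work: whenever a pair of
  adjacent vertices separates the graph, the induction hypothesis applies to one side of it.
\<close>

lemma k4_model_if_degrees_ge_3_except_edge:
  assumes "simple_rel V E" "E x y" "V - {x, y} \<noteq> {}"
    and "\<And>v. v \<in> V - {x, y} \<Longrightarrow> card {w. E v w} \<ge> 3"
  shows "\<exists>B. complete_model 4 V E B"
  using assms
proof (induction "card V" arbitrary: V E x y rule: less_induct)
  case less
  note E = less.prems(1) and deg = less.prems(4)
  have fin: "finite V" using simple_relD[OF E] by blast
  have sym: "\<And>a b. E a b \<Longrightarrow> E b a" and irr: "\<And>a. \<not> E a a"
    and inV: "\<And>a b. E a b \<Longrightarrow> a \<in> V \<and> b \<in> V"
    using simple_relD[OF E] by blast+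
  have xyV: "x \<in> V" "y \<in> V" "x \<noteq> y" using less.prems(2) inV irr by blast+
  \<comment> \<open>Inner vertices of \<open>W\<close> have all their neighbours in
    \<open>W\<close>, so they keep their degrees in the induced subgraph, and the induction
    hypothesis applies with \<open>p q\<close> as the exceptional edge.\<close>
  have sub: ?case
    if W: "W \<subset> V" and pq: "E p q" "p \<in> W" "q \<in> W" and ne: "W - {p, q} \<noteq> {}"
      and cl: "\<And>v u. v \<in> W - {p, q} \<Longrightarrow> E v u \<Longrightarrow> u \<in> W"
      and d: "\<And>v. v \<in> W - {p, q} \<Longrightarrow> card {w. E v w} \<ge> 3" for W p q
  proof -
    let ?E = "\<lambda>a b. E a b \<and> a \<in> W \<and> b \<in> W"
    have VW: "V \<inter> W = W" using W by blast
    have "card W < card V" using W fin psubset_card_mono by blast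
    moreover have "simple_rel W ?E" using simple_rel_induced[OF E, of W] VW by simp
    moreover have "card {w. ?E v w} \<ge> 3" if "v \<in> W - {p, q}" for v
    proof -
      have "{w. ?E v w} = {w. E v w}" using cl[OF that] that by blast
      then show ?thesis using d[OF that] by simp
    qed
    ultimately obtain B where "complete_model 4 W ?E B"
      using less.hyps[of W ?E p q] pq ne by blast
    then show ?thesis using complete_model_mono[of 4 W ?E B V E] W by blast
  qed
  \<comment> \<open>Here \<open>x\<close> and \<open>y\<close> are quantified afresh, so that their
    roles can be swapped later. The plan is to contract the edge from \<open>x\<close> to a further
    neighbour \<open>z\<close>, unless an obstruction already yields the model.\<close>
  have main: ?case
    if xy: "E x y" and z: "E x z" "z \<noteq> y" and deg: "\<And>v. v \<in> V - {x, y} \<Longrightarrow> card {w. E v w} \<ge> 3"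
    for x y z
  proof -
    have V: "x \<in> V" "y \<in> V" "z \<in> V" and ne: "x \<noteq> y" "x \<noteq> z" using xy z inV irr by blast+
    have dz: "card {w. E z w} \<ge> 3" using deg V ne z by blast
    show ?thesis
    proof (cases "cut_connected E (V - {x, z})")
      case False
      moreover have "V - {x, z} \<noteq> {}" using V ne z by blast
      ultimately obtain A where A: "A \<subseteq> V - {x, z}" "A \<noteq> {}" "A \<noteq> V - {x, z}"
        and noA: "\<And>a b. a \<in> A \<Longrightarrow> b \<in> V - {x, z} - A \<Longrightarrow> \<not> E a b"
        unfolding cut_connected_def by blast
      \<comment> \<open>\<open>D\<close> is the side of the separation avoiding \<open>y\<close>.
        All its vertices have degree at least 3, and \<open>x z\<close> becomes the exceptional edge
        of the smaller graph.\<close>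
      define D where "D = (if y \<in> A then V - {x, z} - A else A)"
      have D: "D \<subseteq> V - {x, z}" "D \<noteq> {}" "y \<notin> D" using A by (auto simp: D_def)
      have cl: "u \<in> insert x (insert z D)" if "v \<in> D" "E v u" for u v
      proof (rule ccontr)
        assume "u \<notin> insert x (insert z D)"
        then have "u \<in> V - {x, z}" "u \<notin> D" using inV that(2) by auto
        then show False
          using that sym[OF that(2)] noA[of v u] noA[of u v] by (auto simp: D_def split: if_splits)
      qed
      show ?thesis
      proof (rule sub[of "insert x (insert z D)" x z])
        show "insert x (insert z D) \<subset> V" using D V ne z by blast
        show "insert x (insert z D) - {x, z} \<noteq> {}" using D by blast
        show "u \<in> insert x (insert z D)" if "v \<in> insert x (insert z D) - {x, z}" "E v u" for v u
          using cl[of v u] that by blast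
        show "card {w. E v w} \<ge> 3" if "v \<in> insert x (insert z D) - {x, z}" for v
          using deg[of v] D that by blast
      qed (use z in auto)
    next
      case conn: True
      show ?thesis
      \<comment> \<open>A remaining vertex other than \<open>x\<close> loses a neighbour in the
        contraction only if it is adjacent to both \<open>x\<close> and \<open>z\<close>. This is
        harmful only at degree 3, and there the triangle \<open>x z w\<close> gives the model
        directly.\<close>
      proof (cases "\<exists>w. w \<noteq> y \<and> E x w \<and> E z w \<and> card {u. E w u} = 3")
        case True
        then obtain w where w: "w \<noteq> y" "E x w" "E z w" "card {u. E w u} = 3" by blast
        have w_ne: "w \<noteq> x" "w \<noteq> z" using w irr by blast+
        obtain t where t: "E w t" "t \<noteq> x" "t \<noteq> z"
          using card_ge_3_other[of "{u. E w u}" x z] w(4) by auto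
        \<comment> \<open>These are all the neighbours of \<open>w\<close>, so once \<open>x\<close>
          and \<open>z\<close> are deleted only \<open>t\<close> is left and \<open>w\<close> can be
          removed without disconnecting the rest.\<close>
        have "{x, z, t} = {u. E w u}"
        proof (rule card_subset_eq)
          show "finite {u. E w u}" using finite_nbrs[OF E] .
          show "{x, z, t} \<subseteq> {u. E w u}" using w t sym by blast
          show "card {x, z, t} = card {u. E w u}" using w(4) t ne by simp
        qed
        then have "u \<in> {x, z, t}" if "E w u" for u using that by simp
        then have leaf: "a = t" if "a \<in> V - {x, z}" "E w a \<or> E a w" for a
          using sym[of a w] that by auto
        obtain s where s: "E z s" "s \<noteq> x" "s \<noteq> w"
          using card_ge_3_other[of "{u. E z u}" x w] dz by auto
        have "cut_connected E (V - {x, z} - {w})"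
        proof (rule cut_connected_remove_leaf[OF conn])
          have "y \<in> V - {x, z}" using V ne z by simp
          then show "V - {x, z} \<noteq> {w}" using w(1) by (metis singletonD)
          show "a = t" if "a \<in> V - {x, z}" "E a w" for a using leaf that by simp
          show "a = t" if "a \<in> V - {x, z}" "E w a" for a using leaf that by simp
        qed
        moreover have "V - {x, z} - {w} = V - {x, z, w}" by blast
        ultimately have c: "cut_connected E (V - {x, z, w})" by simp
        \<comment> \<open>In the rest, \<open>y\<close> is adjacent to \<open>x\<close>,
          \<open>s\<close> to \<open>z\<close> and \<open>t\<close> to \<open>w\<close>; these three
          need not be distinct.\<close>
        show ?thesis
          by (rule k4_model_from_parts[OF E z(1) w(2,3) c subset_refl, of y s t])
            (use V ne z w s t xy irr inV in blast)+
      next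
        case False
        let ?C = "contract E x z"
        \<comment> \<open>This neighbour of \<open>z\<close> ensures that a vertex besides
          \<open>x\<close> and \<open>y\<close> survives the contraction.\<close>
        obtain u where u: "E z u" "u \<noteq> x" "u \<noteq> y"
          using card_ge_3_other[of "{u. E z u}" x y] dz by auto
        have "\<exists>B. complete_model 4 (V - {z}) ?C B"
        proof (rule less.hyps[of "V - {z}" ?C x y])
          show "card (V - {z}) < card V" using V fin by (meson card_Diff1_less)
          show "simple_rel (V - {z}) ?C" using simple_rel_contract[OF E V(1)] .
          show "?C x y" using xy z ne by (auto simp: contract_def)
          show "V - {z} - {x, y} \<noteq> {}" using u inV irr by blast
          fix v assume v: "v \<in> V - {z} - {x, y}"
          then have d: "card {w. E v w} \<ge> 3" using deg by blast
          have fv: "finite {w. E v w}" and fC: "finite {w. ?C v w}"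
            using finite_nbrs[OF E] finite_nbrs[OF simple_rel_contract[OF E V(1)]] by blast+
          show "card {w. ?C v w} \<ge> 3"
          proof (cases "E v z")
            case vz: False
            then have "{w. E v w} \<subseteq> {w. ?C v w}" using v irr by (auto simp: contract_def)
            then show ?thesis using d card_mono[OF fC] by (meson le_trans)
          next
            case vz: True
            show ?thesis
            proof (cases "E v x")
              case True
              \<comment> \<open>A common neighbour of \<open>x\<close> and \<open>z\<close> has
                degree at least 4 here, so it can afford to lose \<open>z\<close>.\<close>
              then have "card {w. E v w} \<noteq> 3" using False v vz sym by blast
              moreover have "{w. E v w} - {z} \<subseteq> {w. ?C v w}" using v irr by (auto simp: contract_def)
              then have "card ({w. E v w} - {z}) \<le> card {w. ?C v w}" using card_mono[OF fC] by blast
              moreover have "card ({w. E v w} - {z}) = card {w. E v w} - 1" using vz by simp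
              ultimately show ?thesis using d by linarith
            next
              case nvx: False
              \<comment> \<open>Without an edge to \<open>x\<close> beforehand, the neighbour
                \<open>z\<close> is merely replaced by \<open>x\<close>.\<close>
              have "insert x ({w. E v w} - {z}) \<subseteq> {w. ?C v w}"
                using v irr vz ne by (auto simp: contract_def)
              then have "card (insert x ({w. E v w} - {z})) \<le> card {w. ?C v w}"
                using card_mono[OF fC] by blast
              moreover have "card (insert x ({w. E v w} - {z})) = card {w. E v w}"
                using vz nvx fv d by (simp add: card_insert_if)
              ultimately show ?thesis using d by linarith
            qed
          qed
        qed
        then show ?thesis using complete_model_uncontract[OF E z(1)] by blast
      qed
    qed
  qed
  consider z where "E x z" "z \<noteq> y" | z where "E y z" "z \<noteq> x"
    | "\<And>z. E x z \<Longrightarrow> z = y" "\<And>z. E y z \<Longrightarrow> z = x" by blast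
  then show ?case
  proof cases
    case 1
    then show ?thesis using main[of x y z] less.prems(2) deg by blast
  next
    case 2
    then show ?thesis using main[of y x z] less.prems(2) deg sym by (simp add: insert_commute)
  next
    case 3
    \<comment> \<open>Now \<open>x\<close> and \<open>y\<close> form a component of their own. It is
      dropped, and any edge \<open>p q\<close> of the rest serves as the exceptional one.\<close>
    obtain p where p: "p \<in> V - {x, y}" using less.prems(3) by blast
    obtain q where q: "E p q" using card_ge_3_other[OF deg[OF p], of p p] by auto
    obtain r where r: "E p r" "r \<noteq> p" "r \<noteq> q" using card_ge_3_other[OF deg[OF p], of p q] by auto
    have W: "u \<in> V - {x, y}" if "v \<in> V - {x, y}" "E v u" for u v
      using 3 that sym inV by blast
    show ?thesis
    proof (rule sub[of "V - {x, y}" p q])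
      show "V - {x, y} \<subset> V" using xyV by blast
      show "V - {x, y} - {p, q} \<noteq> {}" using W[OF p r(1)] r by blast
    qed (use p q W deg in blast)+
  qed
qed

text \<open>If all degrees were at least 3, any edge could be taken as the exceptional one.\<close>

lemma exists_degree_le_2:
  assumes E: "simple_rel V E" and "V \<noteq> {}" and "\<nexists>B. complete_model 4 V E B"
  shows "\<exists>v\<in>V. card {w. E v w} \<le> 2"
proof (rule ccontr)
  assume "\<not> ?thesis"
  then have deg: "card {w. E v w} \<ge> 3" if "v \<in> V" for v using that by force
  obtain x where x: "x \<in> V" using assms by blast
  obtain y where y: "E x y" using card_ge_3_other[OF deg[OF x], of x x] by auto
  obtain z where z: "E x z" "z \<noteq> x" "z \<noteq> y" using card_ge_3_other[OF deg[OF x], of x y] by auto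
  have "V - {x, y} \<noteq> {}" using z simple_relD[OF E] by blast
  then show False
    using k4_model_if_degrees_ge_3_except_edge[OF E y] deg assms(3) by blast
qed

section \<open>Extending and constructing odd colorings\<close>

definition odd_colour :: "('a \<Rightarrow> 'a \<Rightarrow> bool) \<Rightarrow> ('a \<Rightarrow> 'c) \<Rightarrow> 'a \<Rightarrow> 'c \<Rightarrow> bool" where
  "odd_colour E c v i \<longleftrightarrow> odd (card {u. E v u \<and> c u = i})"

text \<open>The case \<open>b = a\<close> is allowed, so degree 1 needs no separate
  treatment.\<close>

lemma card_le_2_subset:
  assumes "finite N" "card N \<le> 2" "a \<in> N"
  obtains b where "N = {a, b}"
proof -
  have "card (N - {a}) \<le> 1" using assms by simp
  then consider "N - {a} = {}" | b where "N - {a} = {b}"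
    using assms(1) by (metis card_0_eq card_1_singletonE finite_Diff le_Suc_eq le_zero_eq One_nat_def)
  then show ?thesis using that assms(3) by cases blast+
qed

text \<open>
  A neighbour \<open>u\<close> of \<open>v\<close> loses its oddness only if the colour of \<open>v\<close> is the unique colour that is
  odd around \<open>u\<close> without \<open>v\<close>. If there is no unique such colour, the \<open>THE\<close> in \<open>forb\<close> below
  harmlessly excludes one arbitrary colour.
\<close>

lemma odd_5_coloring_extend:
  assumes E: "simple_rel V E" and v: "v \<in> V" "card {w. E v w} \<le> 2"
    and F: "\<And>a b. F a b \<longleftrightarrow> a \<noteq> v \<and> b \<noteq> v \<and> (E a b \<or> a \<noteq> b \<and> E v a \<and> E v b)"
    and c: "\<And>a b. F a b \<Longrightarrow> c a \<noteq> c b" "c ` (V - {v}) \<subseteq> {1..5::nat}"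
      "\<And>a b. F a b \<Longrightarrow> \<exists>i. odd_colour F c a i"
  shows "\<exists>c. (\<forall>a b. E a b \<longrightarrow> c a \<noteq> c b) \<and> c ` V \<subseteq> {1..5::nat} \<and>
    (\<forall>a b. E a b \<longrightarrow> (\<exists>i. odd_colour E c a i))"
proof -
  have sym: "\<And>a b. E a b \<Longrightarrow> E b a" and irr: "\<And>a. \<not> E a a"
    using simple_relD[OF E] by blast+
  let ?N = "{w. E v w}"
  have fN: "finite ?N" using finite_nbrs[OF E] .
  define odds where "odds u = {i. odd (card ({w. E u w \<and> w \<noteq> v \<and> c w = i}))}" for u
  define forb where "forb = c ` ?N \<union> (\<lambda>u. THE i. odds u = {i}) ` ?N"
  have "card forb \<le> card (c ` ?N) + card ((\<lambda>u. THE i. odds u = {i}) ` ?N)"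
    unfolding forb_def by (rule card_Un_le)
  also have "\<dots> \<le> 2 + 2" using v(2) card_image_le[OF fN] by (meson add_mono le_trans)
  finally have "card forb < card {1..5::nat}" by simp
  moreover have "finite forb" using fN by (simp add: forb_def)
  ultimately obtain a where a: "a \<in> {1..5}" "a \<notin> forb"
    by (metis card_mono linorder_not_less subsetI)
  define d where "d = c(v := a)"
  have dv: "d v = a" and dc: "\<And>u. u \<noteq> v \<Longrightarrow> d u = c u" by (auto simp: d_def)
  have proper: "d p \<noteq> d q" if pq: "E p q" for p q
  proof (cases "p = v \<or> q = v")
    case True
    have "a \<noteq> c u" if "E v u" for u using a that by (auto simp: forb_def)
    then show ?thesis using True pq sym irr dv dc by metis
  next
    case False
    then show ?thesis using c(1)[of p q] F pq dc by simp
  qed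
  have oddv: "\<exists>i. odd_colour E d v i" if "E v q" for q
  proof -
    \<comment> \<open>Any other neighbour of \<open>v\<close> is adjacent to \<open>q\<close> in
      \<open>F\<close> and hence coloured differently, so the colour of \<open>q\<close> occurs
      exactly once.\<close>
    have "{u. E v u \<and> d u = d q} = {q}"
    proof -
      have "d u \<noteq> d q" if "E v u" "u \<noteq> q" for u
        using c(1)[of u q] F that \<open>E v q\<close> irr dc by metis
      then show ?thesis using that by blast
    qed
    then show ?thesis unfolding odd_colour_def by (metis card.empty card.insert empty_iff finite.emptyI odd_one One_nat_def)
  qed
  have oddN: "\<exists>i. odd_colour E d u i" if u: "E v u" for u
  proof -
    have fu: "finite {w. E u w}" using finite_nbrs[OF E] .
    have other: "{w. E u w \<and> d w = i} = {w. E u w \<and> w \<noteq> v \<and> c w = i}" if "i \<noteq> a" for i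
      using that by (auto simp: d_def)
    have this_a: "{w. E u w \<and> d w = a} = insert v {w. E u w \<and> w \<noteq> v \<and> c w = a}"
      using sym[OF u] by (auto simp: d_def)
    show ?thesis
    \<comment> \<open>Colouring \<open>v\<close> changes only the parity of \<open>a\<close> around
      \<open>u\<close>. An odd colour other than \<open>a\<close> survives; otherwise
      \<open>odds u\<close> is empty because \<open>a\<close> is not forbidden, and \<open>v\<close>
      makes \<open>a\<close> odd.\<close>
    proof (cases "\<exists>i\<in>odds u. i \<noteq> a")
      case True
      then obtain i where "i \<in> odds u" "i \<noteq> a" by blast
      then have "odd_colour E d u i" by (simp add: odds_def odd_colour_def other)
      then show ?thesis by blast
    next
      case False
      have "odds u \<noteq> {a}"
      proof
        assume "odds u = {a}"
        then have "(THE i. odds u = {i}) = a" by simp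
        then show False using a u unfolding forb_def by blast
      qed
      then have "a \<notin> odds u" using False by blast
      then have "odd (card {w. E u w \<and> d w = a})"
        using fu by (simp add: this_a odds_def)
      then show ?thesis unfolding odd_colour_def by blast
    qed
  qed
  have "\<exists>i. odd_colour E d p i" if pq: "E p q" for p q
  proof -
    consider "p = v" | "E v p" | "p \<noteq> v" "\<not> E v p" by blast
    then show ?thesis
    proof cases
      case 1
      then show ?thesis using oddv pq by blast
    next
      case 2
      then show ?thesis using oddN by blast
    next
      case 3
      \<comment> \<open>The added edge joins only neighbours of \<open>v\<close>, so the
        neighbourhood of \<open>p\<close> and the colours on it are unchanged.\<close>
      have "E p w \<and> d w = i \<longleftrightarrow> F p w \<and> c w = i" for w i
        using F 3 sym dc by metis
      moreover have "F p q" using F 3 pq sym by blast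
      ultimately show ?thesis using c(3)[of p q] unfolding odd_colour_def by simp
    qed
  qed
  moreover have "d ` V \<subseteq> {1..5}" using c(2) a(1) by (auto simp: d_def)
  ultimately show ?thesis using proper by blast
qed

lemma odd_5_coloring_if_no_k4_model:
  assumes "simple_rel V E" "\<nexists>B. complete_model 4 V E B"
  shows "\<exists>c. (\<forall>a b. E a b \<longrightarrow> c a \<noteq> c b) \<and> c ` V \<subseteq> {1..5::nat} \<and>
    (\<forall>a b. E a b \<longrightarrow> (\<exists>i. odd_colour E c a i))"
  using assms
proof (induction "card V" arbitrary: V E rule: less_induct)
  case less
  note E = less.prems(1)
  show ?case
  proof (cases "V = {}")
    case True
    then show ?thesis using simple_relD[OF E] by blast
  next
    case False
    obtain v where v: "v \<in> V" "card {w. E v w} \<le> 2"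
      using exists_degree_le_2[OF E False less.prems(2)] by blast
    define F where "F a b \<longleftrightarrow> a \<noteq> v \<and> b \<noteq> v \<and> (E a b \<or> a \<noteq> b \<and> E v a \<and> E v b)" for a b
    have "simple_rel (V - {v}) F"
      using E unfolding simple_rel_def F_def by blast
    moreover have "\<nexists>B. complete_model 4 (V - {v}) F B"
    proof
      assume "\<exists>B. complete_model 4 (V - {v}) F B"
      then obtain B where B: "complete_model 4 (V - {v}) F B" ..
      show False
      proof (cases "\<exists>u. E v u")
        case False
        have "complete_model 4 V E B"
          by (rule complete_model_mono[OF B]) (use False in \<open>auto simp: F_def\<close>)
        then show False using less.prems(2) by blast
      next
        case True
        \<comment> \<open>With \<open>u\<close> and \<open>w\<close> the neighbours of
          \<open>v\<close>, possibly equal, the only edge that \<open>F\<close> can add is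
          \<open>u w\<close>, and contracting \<open>u v\<close> creates it as well.\<close>
        then obtain u where u: "E v u" ..
        then obtain w where w: "{w. E v w} = {u, w}"
          using card_le_2_subset[OF finite_nbrs[OF E] v(2), of u] by blast
        have "E u v" using u simple_relD[OF E] by blast
        have "contract E u v a b" if "F a b" for a b
        proof -
          have "a \<in> {u, w} \<and> b \<in> {u, w}" if "E v a" "E v b" using that w by blast
          moreover have "E v a \<Longrightarrow> E a v" "\<not> E a a" using simple_relD[OF E] by blast+
          ultimately show ?thesis using that unfolding F_def contract_def by auto
        qed
        then have "complete_model 4 (V - {v}) (contract E u v) B"
          using complete_model_mono[OF B] by blast
        then show False using complete_model_uncontract[OF E \<open>E u v\<close>] less.prems(2) by blast
      qed
    qed
    moreover have "card (V - {v}) < card V"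
      using v simple_relD[OF E] by (meson card_Diff1_less)
    ultimately obtain c where "\<forall>a b. F a b \<longrightarrow> c a \<noteq> c b" "c ` (V - {v}) \<subseteq> {1..5::nat}"
      "\<forall>a b. F a b \<longrightarrow> (\<exists>i. odd_colour F c a i)"
      using less.hyps[of "V - {v}" F] by blast
    then show ?thesis
      using odd_5_coloring_extend[OF E v F_def, of c] by blast
  qed
qed

section \<open>Transfer to the digraph library\<close>

text \<open>The vertices reachable from \<open>u\<close> inside \<open>S\<close> form a set that no
  edge within \<open>S\<close> leaves, so they exhaust \<open>S\<close>.\<close>

lemma connected_induce_subgraph:
  fixes G :: "('a, 'b) pre_digraph"
  assumes "wf_digraph G" "cut_connected (\<lambda>u v. u \<rightarrow>\<^bsub>G\<^esub> v) S"
  shows "Digraph_Component.connected (G \<restriction> S)"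
proof -
  interpret wf_digraph G by fact
  interpret H: wf_digraph "G \<restriction> S" by (rule wellformed_induce_subgraph)
  have "u \<rightarrow>\<^sup>*\<^bsub>G \<restriction> S\<^esub> v" if u: "u \<in> S" and v: "v \<in> S" for u v
  proof (rule ccontr)
    assume nr: "\<not> ?thesis"
    define A where "A = {w \<in> S. u \<rightarrow>\<^sup>*\<^bsub>G \<restriction> S\<^esub> w}"
    have "u \<in> A" using u by (simp add: A_def)
    then have "A \<subseteq> S" "A \<noteq> {}" "A \<noteq> S" using v nr by (auto simp: A_def)
    then obtain a b where ab: "a \<in> A" "b \<in> S - A" "a \<rightarrow>\<^bsub>G\<^esub> b"
      using cut_connectedD[OF assms(2)] by metis
    then have "a \<rightarrow>\<^bsub>G \<restriction> S\<^esub> b" by (auto simp: A_def arcs_ends_def arc_to_ends_def)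
    then have "u \<rightarrow>\<^sup>*\<^bsub>G \<restriction> S\<^esub> b"
      using ab(1) unfolding A_def by (auto intro: H.reachable_adj_trans)
    then show False using ab(2) by (simp add: A_def)
  qed
  \<comment> \<open>Library connectedness is strong connectedness of the symmetric closure, so
    reachability is passed on to it.\<close>
  then have "u \<rightarrow>\<^sup>*\<^bsub>mk_symmetric (G \<restriction> S)\<^esub> v" if "u \<in> S" "v \<in> S" for u v
    using H.reachable_mk_symmetricI that by blast
  then show ?thesis
    using assms(2) unfolding connected_def cut_connected_def
    by (intro strongly_connectedI) simp_all
qed

lemma complete_model_imp_has_complete_minor:
  fixes G :: "('a, 'b) pre_digraph"
  assumes "graph G" "complete_model n (verts G) (\<lambda>u v. u \<rightarrow>\<^bsub>G\<^esub> v) B"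
  shows "has_complete_minor n G"
proof -
  interpret graph G by fact
  \<comment> \<open>The vertices of this complete graph are the indices of the branch sets, so
    \<open>B\<close> itself is the minor model.\<close>
  define H :: "nat pair_pre_digraph" where
    "H = \<lparr>pverts = {..<n}, parcs = {(u, v). u < n \<and> v < n \<and> u \<noteq> v}\<rparr>"
  have "K\<^bsub>n\<^esub> (with_proj H)" by (auto simp: complete_digraph_pair_def H_def)
  moreover have "minor_model (with_proj H) G B"
    using assms(2) connected_induce_subgraph[OF wf_digraph]
    unfolding minor_model_def complete_model_def by (simp add: H_def)
  ultimately show ?thesis unfolding has_complete_minor_def is_minor_def by blast
qed

theorem corollary3:
  fixes G :: "('a, 'b) pre_digraph"
  assumes "graph G"
    and "\<not> has_complete_minor 4 G"
  shows "\<exists>c. odd_k_coloring 5 G c"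
proof -
  interpret graph G by fact
  let ?E = "\<lambda>u v. u \<rightarrow>\<^bsub>G\<^esub> v"
  have "simple_rel (verts G) ?E"
    unfolding simple_rel_def
    using adj_in_verts adj_not_same graph_symmetric finite_verts by blast
  moreover have "\<nexists>B. complete_model 4 (verts G) ?E B"
    using complete_model_imp_has_complete_minor[OF assms(1)] assms(2) by blast
  ultimately obtain c where "\<forall>a b. ?E a b \<longrightarrow> c a \<noteq> c b" "c ` verts G \<subseteq> {1..5::nat}"
    "\<forall>a b. ?E a b \<longrightarrow> (\<exists>i. odd_colour ?E c a i)"
    using odd_5_coloring_if_no_k4_model by blast
  then have "odd_k_coloring 5 G c"
    unfolding odd_k_coloring_def odd_coloring_def proper_coloring_def isolated_def
      neighborhood_def odd_colour_def by auto
  then show ?thesis by blast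
qed

end
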